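(* Let $n\ge 1$. Let $\alpha:\mathbb{R}\rightarrow\mathbb{R}$ be a smooth function such that $\alpha(t)>0$ for all $t$ and such that the function $h(t):=\alpha(t)\sinh t$ has nonzero derivative for all $t\in\mathbb{R}$. Let $f:=\alpha\circ h^{-1}$, defined on the open interval $h(\mathbb{R})$. Then $dS_{n+1}(f)$ is isometric to $\mathbb{R}\times S^n$ with metric $$g=\left((\alpha')^2-\alpha^2\right)dt\otimes dt+\alpha^2\cosh^2 t\;\pi^\ast\Omega_n,$$ where $\alpha':=\frac{d\alpha}{dt}$, $\Omega_n$ is the round metric on the unit sphere $S^n$, and $\pi:\mathbb{R}\times S^n\rightarrow S^n$ is the projection map.
   Context: $\mathbb{R}^{n+2}_1$ denotes $(n+2)$-dimensional Minkowski space, i.e. $\mathbb{R}^{n+2}$ with coordinates $(x^0,\dots,x^{n+1})$ and metric $\eta=-dx^0\otimes dx^0+dx^1\otimes dx^1+\cdots+dx^{n+1}\otimes dx^{n+1}$. For a smooth function $f:(a,b)\to\mathbb{R}$ on an open interval (possibly unbounded), $dS_{n+1}(f)$ denotes the hypersurface $\{x\in\mathbb{R}^{n+2}_1 : x^0\in(a,b),\ -(x^0)^2+(x^1)^2+\cdots+(x^{n+1})^2=f(x^0)^2\}$ with the metric induced from $\eta$, i.e. $i^\ast\eta$ with $i$ the inclusion. The word "metric" is used loosely here: the induced symmetric $(0,2)$-tensor $i^\ast\eta$ may be degenerate or of any signature, and "isometric" means that there is a diffeomorphism under which the symmetric $(0,2)$-tensors correspond by pullback. *)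

theory Defs
  imports "HOL-Analysis.Analysis"
begin

text \<open>Smooth functions on an open set, by iterated directional derivatives: the set \<open>S\<close> is
  meant to be open.\<close>

primrec Ck_on :: "nat \<Rightarrow> 'a::real_normed_vector set \<Rightarrow> ('a \<Rightarrow> 'b::real_normed_vector) \<Rightarrow> bool" where
  "Ck_on 0 S f \<longleftrightarrow> continuous_on S f"
| "Ck_on (Suc k) S f \<longleftrightarrow>
     (\<forall>x\<in>S. f differentiable (at x)) \<and>
     (\<forall>v. Ck_on k S (\<lambda>x. frechet_derivative f (at x) v))"

definition smooth_on :: "'a::real_normed_vector set \<Rightarrow> ('a \<Rightarrow> 'b::real_normed_vector) \<Rightarrow> bool" where
  "smooth_on S f \<longleftrightarrow> (\<forall>k. Ck_on k S f)"

text \<open>Manifolds are embedded submanifolds of Euclidean spaces and are represented by their underlying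
  sets. A map on such a set is smooth iff locally it extends to a smooth map on an open subset of the
  ambient space; tangent vectors are the velocities of smooth curves in the set. In particular a set diffeomorphic, in this sense, to a
  submanifold is itself a submanifold.\<close>

definition smooth_map :: "'a::euclidean_space set \<Rightarrow> ('a \<Rightarrow> 'b::euclidean_space) \<Rightarrow> bool" where
  "smooth_map M \<phi> \<longleftrightarrow>
     (\<forall>p\<in>M. \<exists>U F. open U \<and> p \<in> U \<and> smooth_on U F \<and> (\<forall>x\<in>U \<inter> M. F x = \<phi> x))"

definition diffeomorphism ::
  "'a::euclidean_space set \<Rightarrow> 'b::euclidean_space set \<Rightarrow> ('a \<Rightarrow> 'b) \<Rightarrow> bool" where
  "diffeomorphism M N \<phi> \<longleftrightarrow>
     bij_betw \<phi> M N \<and> smooth_map M \<phi> \<and> smooth_map N (inv_into M \<phi>)"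

definition curve_at :: "'a::euclidean_space set \<Rightarrow> 'a \<Rightarrow> 'a \<Rightarrow> (real \<Rightarrow> 'a) \<Rightarrow> bool" where
  "curve_at M p v \<gamma> \<longleftrightarrow>
     (\<exists>e>0. smooth_on {-e<..<e} \<gamma> \<and> \<gamma> ` {-e<..<e} \<subseteq> M) \<and>
     \<gamma> 0 = p \<and> (\<gamma> has_vector_derivative v) (at 0)"

definition tangent_space :: "'a::euclidean_space set \<Rightarrow> 'a \<Rightarrow> 'a set" where
  "tangent_space M p = {v. \<exists>\<gamma>. curve_at M p v \<gamma>}"

text \<open>The differential at \<open>p\<close> of a smooth map on \<open>M\<close>; only its values on \<open>tangent_space M p\<close>
  are meaningful.\<close>

definition differential ::
  "'a::euclidean_space set \<Rightarrow> ('a \<Rightarrow> 'b::euclidean_space) \<Rightarrow> 'a \<Rightarrow> 'a \<Rightarrow> 'b" where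
  "differential M \<phi> p v =
     (THE w. \<forall>\<gamma>. curve_at M p v \<gamma> \<longrightarrow> ((\<phi> \<circ> \<gamma>) has_vector_derivative w) (at 0))"

text \<open>A \<open>(0,2)\<close>-tensor field on a submanifold of \<open>'a\<close>: its value at \<open>p\<close> is a function of two vectors,
  of which only the values on tangent vectors at \<open>p\<close> are meaningful. No signature or nondegeneracy is
  required.\<close>

type_synonym 'a tensor02 = "'a \<Rightarrow> 'a \<Rightarrow> 'a \<Rightarrow> real"

definition pullback ::
  "'a::euclidean_space set \<Rightarrow> ('a \<Rightarrow> 'b::euclidean_space) \<Rightarrow> 'b tensor02 \<Rightarrow> 'a tensor02" where
  "pullback M \<phi> g = (\<lambda>p v w. g (\<phi> p) (differential M \<phi> p v) (differential M \<phi> p w))"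

definition induced :: "'a::euclidean_space set \<Rightarrow> 'a tensor02 \<Rightarrow> 'a tensor02" where
  "induced M g = pullback M (\<lambda>x. x) g"

definition isometric ::
  "'a::euclidean_space set \<Rightarrow> 'a tensor02 \<Rightarrow> 'b::euclidean_space set \<Rightarrow> 'b tensor02 \<Rightarrow> bool" where
  "isometric M g N k \<longleftrightarrow>
     (\<exists>\<phi>. diffeomorphism M N \<phi> \<and>
       (\<forall>p\<in>M. \<forall>v\<in>tangent_space M p. \<forall>w\<in>tangent_space M p. pullback M \<phi> k p v w = g p v w))"

text \<open>Minkowski space of dimension \<open>CARD('m) + 1\<close> is the type \<open>real \<times> (real^'m)\<close>: the first component
  is the time coordinate, the second one the vector of space coordinates.\<close>

definition minkowski :: "(real \<times> (real^'m)) tensor02" where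
  "minkowski p v w = - (fst v * fst w) + (\<Sum>i\<in>UNIV. snd v $ i * snd w $ i)"

text \<open>The hypersurface for a function \<open>f\<close> with domain the open interval \<open>J\<close>.\<close>

definition dS :: "real set \<Rightarrow> (real \<Rightarrow> real) \<Rightarrow> (real \<times> (real^'m)) set" where
  "dS J f = {x. fst x \<in> J \<and> - (fst x)\<^sup>2 + (\<Sum>i\<in>UNIV. (snd x $ i)\<^sup>2) = (f (fst x))\<^sup>2}"

definition unit_sphere :: "(real^'m) set" where
  "unit_sphere = sphere 0 1"

definition round_metric :: "(real^'m) tensor02" where
  "round_metric = induced unit_sphere (\<lambda>p v w. v \<bullet> w)"

definition cylinder :: "(real \<times> (real^'m)) set" where
  "cylinder = UNIV \<times> unit_sphere"

text \<open>Here \<open>differential cylinder fst\<close> is the one-form \<open>dt\<close>, and \<open>snd\<close> is the projection onto the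
  sphere.\<close>

definition cylinder_metric :: "(real \<Rightarrow> real) \<Rightarrow> (real \<times> (real^'m)) tensor02" where
  "cylinder_metric \<alpha> = (\<lambda>p v w. let t = fst p in
     ((deriv \<alpha> t)\<^sup>2 - (\<alpha> t)\<^sup>2) * (differential cylinder fst p v * differential cylinder fst p w)
     + (\<alpha> t)\<^sup>2 * (cosh t)\<^sup>2 * pullback cylinder snd round_metric p v w)"

end

theory Submission
  imports Defs
begin

text \<open>
  Write \<open>c t = \<alpha> t * cosh t\<close>. By \<open>cosh\<^sup>2 - sinh\<^sup>2 = 1\<close>, the hypersurface consists of the points whose
  time coordinate is \<open>h t\<close> for some \<open>t\<close> and whose space part has norm \<open>c t\<close>. Since \<open>h'\<close> has no zero,
  \<open>h\<close> is a diffeomorphism onto an open interval and \<open>t\<close> is a smooth function of the time coordinate.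
  So \<open>\<psi> (t, u) = (h t, c t *\<^sub>R u)\<close> is a diffeomorphism from the cylinder onto the hypersurface, with
  inverse \<open>\<phi> (s, y) = (k s, y /\<^sub>R c (k s))\<close>, where \<open>k\<close> is the inverse of \<open>h\<close>.

  For a tangent vector \<open>(\<tau>, \<mu>)\<close> at \<open>(t, u)\<close> the differential of \<open>\<psi>\<close> is
  \<open>(h' t * \<tau>, (c' t * \<tau>) *\<^sub>R u + c t *\<^sub>R \<mu>)\<close>. As \<open>u\<close> is a unit vector orthogonal to \<open>\<mu>\<close>, the Minkowski
  form of two such images has no mixed terms and equals
  \<open>((c' t)\<^sup>2 - (h' t)\<^sup>2) * (\<tau> * \<tau>') + (c t)\<^sup>2 * (\<mu> \<bullet> \<mu>')\<close>; and
  \<open>(c')\<^sup>2 - (h')\<^sup>2 = ((\<alpha>')\<^sup>2 - \<alpha>\<^sup>2) * (cosh\<^sup>2 - sinh\<^sup>2) = (\<alpha>')\<^sup>2 - \<alpha>\<^sup>2\<close>. This is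
  \<open>minkowski_parametrization\<close>.

  The isometry has to go from the hypersurface to the cylinder, so \<open>\<phi>\<close> is the map to use; its
  differential is never computed. A tangent vector \<open>v\<close> of the hypersurface is the image under the
  differential of \<open>\<psi>\<close> of the tangent vector that the differential of \<open>\<phi>\<close> assigns to \<open>v\<close>
  (\<open>differential_left_inverse\<close>), and the formula above applies to the latter.

  The rest consists of closure properties of smoothness, of which composition (\<open>Ck_on_compose\<close>) and
  inversion (\<open>Ck_on_inverse_function\<close>) carry the argument, and of the description of the
  differential of a map on a submanifold through a smooth extension (\<open>curve_at_compose\<close>).
\<close>

section \<open>Calculus of smooth functions\<close>

lemma Ck_on_cong:
  assumes "open S" "\<And>x. x \<in> S \<Longrightarrow> f x = g x" "Ck_on k S f"
  shows "Ck_on k S g"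
  using assms(2,3)
proof (induction k arbitrary: f g)
  case 0
  then show ?case
    by (metis Ck_on.simps(1) continuous_on_cong)
next
  case (Suc k)
  have ev: "\<forall>\<^sub>F y in nhds x. f y = g y" if "x \<in> S" for x
    using Suc.prems(1) assms(1) that by (auto simp: eventually_nhds)
  have der: "(g has_derivative frechet_derivative f (at x)) (at x)" if "x \<in> S" for x
  proof (rule has_derivative_transform_within_open[OF _ assms(1) that])
    show "(f has_derivative frechet_derivative f (at x)) (at x)"
      using Suc.prems(2) that by (simp add: frechet_derivative_works)
  qed (use Suc.prems(1) in auto)
  then have "frechet_derivative f (at x) = frechet_derivative g (at x)" if "x \<in> S" for x
    using frechet_derivative_at that by blast
  then have "Ck_on k S (\<lambda>x. frechet_derivative g (at x) v)" for v
    using Suc.IH[of "\<lambda>x. frechet_derivative f (at x) v" "\<lambda>x. frechet_derivative g (at x) v"]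
      Suc.prems(2) by simp
  with der show ?case
    by (auto simp: differentiable_def)
qed

text \<open>This form lets the candidate derivative be given as an explicit formula that is valid on \<open>S\<close>
  only. The inductions on the order below choose a formula to which the induction hypothesis and
  earlier closure properties apply.\<close>

lemma Ck_on_SucI:
  assumes "open S" "\<And>x. x \<in> S \<Longrightarrow> (f has_derivative f' x) (at x)"
    and "\<And>v. Ck_on k S (\<lambda>x. f' x v)"
  shows "Ck_on (Suc k) S f"
proof -
  have "Ck_on k S (\<lambda>x. frechet_derivative f (at x) v)" for v
    by (rule Ck_on_cong[OF assms(1) _ assms(3)[of v]])
      (use assms(2) frechet_derivative_at in metis)
  then show ?thesis
    using assms(2) by (auto simp: differentiable_def)
qed

lemma Ck_on_Suc_has_derivative:
  assumes "Ck_on (Suc k) S f" "x \<in> S"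
  shows "(f has_derivative frechet_derivative f (at x)) (at x)"
  using assms by (simp add: frechet_derivative_works)

lemma Ck_on_lower: "Ck_on (Suc k) S f \<Longrightarrow> Ck_on k S f"
proof (induction k arbitrary: f)
  case 0
  then show ?case
    by (simp add: continuous_at_imp_continuous_on differentiable_imp_continuous_within)
next
  case (Suc k)
  then show ?case
    by (metis Ck_on.simps(2))
qed

lemma Ck_on_subset: "Ck_on k S f \<Longrightarrow> T \<subseteq> S \<Longrightarrow> Ck_on k T f"
  by (induction k arbitrary: f) (auto intro: continuous_on_subset)

lemma Ck_on_const: "open S \<Longrightarrow> Ck_on k S (\<lambda>x. c)"
proof (induction k arbitrary: c)
  case (Suc k)
  show ?case
    by (rule Ck_on_SucI[where f' = "\<lambda>x v. 0"]) (use Suc in auto)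
qed auto

lemma Ck_on_linear:
  assumes "bounded_linear f" "open S"
  shows "Ck_on k S f"
proof (cases k)
  case 0
  then show ?thesis
    by (simp add: assms linear_continuous_on)
next
  case (Suc j)
  have "Ck_on (Suc j) S f"
    by (rule Ck_on_SucI[where f' = "\<lambda>x. f"])
      (use assms in \<open>auto intro: bounded_linear_imp_has_derivative Ck_on_const\<close>)
  then show ?thesis
    using Suc by simp
qed

lemma Ck_on_add:
  assumes "open S" "Ck_on k S f" "Ck_on k S g"
  shows "Ck_on k S (\<lambda>x. f x + g x)"
  using assms(2,3)
proof (induction k arbitrary: f g)
  case 0
  then show ?case
    by (simp add: continuous_on_add)
next
  case (Suc k)
  show ?case
  proof (rule Ck_on_SucI[OF assms(1)])
    fix x assume "x \<in> S"
    then show "((\<lambda>x. f x + g x) has_derivative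
        (\<lambda>v. frechet_derivative f (at x) v + frechet_derivative g (at x) v)) (at x)"
      using Suc.prems by (intro has_derivative_add Ck_on_Suc_has_derivative)
  qed (use Suc in auto)
qed

lemma Ck_on_sum:
  assumes "open S" "finite I" "\<And>i. i \<in> I \<Longrightarrow> Ck_on k S (f i)"
  shows "Ck_on k S (\<lambda>x. \<Sum>i\<in>I. f i x)"
  using assms(2,3)
  by (induction I rule: finite_induct) (auto intro: Ck_on_const Ck_on_add assms(1))

lemma Ck_on_bilinear:
  assumes "bounded_bilinear B" "open S" "Ck_on k S f" "Ck_on k S g"
  shows "Ck_on k S (\<lambda>x. B (f x) (g x))"
  using assms(3,4)
proof (induction k arbitrary: f g)
  case 0
  then show ?case
    by (simp add: bounded_bilinear.continuous_on[OF assms(1)])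
next
  case (Suc k)
  show ?case
  proof (rule Ck_on_SucI[OF assms(2)])
    fix x assume "x \<in> S"
    then show "((\<lambda>x. B (f x) (g x)) has_derivative
        (\<lambda>v. B (f x) (frechet_derivative g (at x) v) + B (frechet_derivative f (at x) v) (g x))) (at x)"
      using Suc.prems by (intro bounded_bilinear.FDERIV[OF assms(1)] Ck_on_Suc_has_derivative)
  next
    fix v
    show "Ck_on k S (\<lambda>x. B (f x) (frechet_derivative g (at x) v) + B (frechet_derivative f (at x) v) (g x))"
      by (intro Ck_on_add[OF assms(2)] Suc.IH) (use Suc.prems Ck_on_lower in auto)
  qed
qed

text \<open>The smoothness of \<open>x \<mapsto> Dg (f x) w\<close> is available only for a fixed direction \<open>w\<close>, whereas the chain
  rule produces the direction \<open>Df x v\<close>, which moves with \<open>x\<close>. Expanding \<open>Df x v\<close> in an orthonormal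
  basis leaves finitely many fixed directions, with smooth coefficients.\<close>

lemma Ck_on_compose:
  fixes f :: "'a::real_normed_vector \<Rightarrow> 'b::euclidean_space"
  assumes "open S" "open T" "f ` S \<subseteq> T" "Ck_on k S f" "Ck_on k T g"
  shows "Ck_on k S (\<lambda>x. g (f x))"
  using assms(4,5)
proof (induction k arbitrary: g)
  case 0
  then show ?case
    by (metis Ck_on.simps(1) assms(3) continuous_on_compose2)
next
  case (Suc k)
  have der: "(f has_derivative frechet_derivative f (at x)) (at x)"
    "(g has_derivative frechet_derivative g (at (f x))) (at (f x))" if "x \<in> S" for x
    using Suc.prems assms(3) that by (auto intro!: Ck_on_Suc_has_derivative)
  show ?case
  proof (rule Ck_on_SucI[OF assms(1)])
    fix x assume x: "x \<in> S"
    let ?D = "frechet_derivative g (at (f x))"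
    have lin: "linear ?D"
      using der(2)[OF x] has_derivative_linear by blast
    have "?D w = (\<Sum>b\<in>Basis. (w \<bullet> b) *\<^sub>R ?D b)" for w
    proof -
      have "?D w = ?D (\<Sum>b\<in>Basis. (w \<bullet> b) *\<^sub>R b)"
        by (simp only: euclidean_representation)
      also have "\<dots> = (\<Sum>b\<in>Basis. (w \<bullet> b) *\<^sub>R ?D b)"
        by (simp only: linear_sum[OF lin] linear_cmul[OF lin])
      finally show ?thesis .
    qed
    then have "(\<lambda>v. ?D (frechet_derivative f (at x) v)) = (\<lambda>v. \<Sum>b\<in>Basis.
        (frechet_derivative f (at x) v \<bullet> b) *\<^sub>R ?D b)"
      by blast
    then show "((\<lambda>x. g (f x)) has_derivative (\<lambda>v. \<Sum>b\<in>Basis.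
        (frechet_derivative f (at x) v \<bullet> b) *\<^sub>R frechet_derivative g (at (f x)) b)) (at x)"
      using has_derivative_compose[OF der(1)[OF x] der(2)[OF x]] by simp
  next
    fix v
    show "Ck_on k S (\<lambda>x. \<Sum>b\<in>Basis.
        (frechet_derivative f (at x) v \<bullet> b) *\<^sub>R frechet_derivative g (at (f x)) b)"
    proof (rule Ck_on_sum[OF assms(1) finite_Basis])
      fix b :: 'b
      have "Ck_on k S (\<lambda>x. frechet_derivative g (at (f x)) b)"
        by (rule Suc.IH) (use Suc.prems Ck_on_lower in auto)
      moreover have "Ck_on k S (\<lambda>x. frechet_derivative f (at x) v \<bullet> b)"
        by (rule Ck_on_bilinear[OF bounded_bilinear_inner assms(1)])
          (use Suc.prems Ck_on_const[OF assms(1)] in auto)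
      ultimately show "Ck_on k S (\<lambda>x. (frechet_derivative f (at x) v \<bullet> b) *\<^sub>R
          frechet_derivative g (at (f x)) b)"
        by (rule Ck_on_bilinear[OF bounded_bilinear_scaleR assms(1), rotated])
    qed
  qed
qed

lemma Ck_on_inverse:
  fixes f :: "'a::real_normed_vector \<Rightarrow> real"
  assumes "open S" "\<And>x. x \<in> S \<Longrightarrow> f x \<noteq> 0" "Ck_on k S f"
  shows "Ck_on k S (\<lambda>x. inverse (f x))"
  using assms(3)
proof (induction k)
  case 0
  then show ?case
    by (simp add: assms(2) continuous_on_inverse)
next
  case (Suc k)
  then have inv: "Ck_on k S (\<lambda>x. inverse (f x))"
    using Ck_on_lower by blast
  show ?case
  proof (rule Ck_on_SucI[OF assms(1)])
    fix x assume "x \<in> S"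
    then show "((\<lambda>x. inverse (f x)) has_derivative
        (\<lambda>v. (- inverse (f x)) * frechet_derivative f (at x) v * inverse (f x))) (at x)"
      using Deriv.has_derivative_inverse[OF assms(2) Ck_on_Suc_has_derivative[OF Suc.prems]] by simp
  next
    fix v
    note mult = Ck_on_bilinear[OF bounded_bilinear_mult assms(1)]
    have "Ck_on k S (\<lambda>x. - inverse (f x))"
      using mult[OF Ck_on_const[OF assms(1), of _ "-1"] inv] by simp
    then show "Ck_on k S (\<lambda>x. (- inverse (f x)) * frechet_derivative f (at x) v * inverse (f x))"
      by (intro mult inv) (use Suc.prems in auto)
  qed
qed

text \<open>Each of the two functions is the derivative of the other, hence the joint induction.\<close>

lemma Ck_on_sinh_cosh:
  "Ck_on k UNIV (sinh :: real \<Rightarrow> real)" "Ck_on k UNIV (cosh :: real \<Rightarrow> real)"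
proof (induction k)
  case 0
  {
    case 1
    show ?case by (simp add: continuous_on_sinh continuous_on_id)
  next
    case 2
    show ?case by (simp add: continuous_on_cosh continuous_on_id)
  }
next
  case (Suc k)
  note scale = Ck_on_bilinear[OF bounded_bilinear_mult open_UNIV _ Ck_on_const[OF open_UNIV]]
  {
    case 1
    show ?case
      by (rule Ck_on_SucI[where f' = "\<lambda>x v. cosh x * v"])
        (use scale[OF Suc(2)] in \<open>auto intro!: derivative_eq_intros
          simp: has_field_derivative_def[symmetric]\<close>)
  next
    case 2
    show ?case
      by (rule Ck_on_SucI[where f' = "\<lambda>x v. sinh x * v"])
        (use scale[OF Suc(1)] in \<open>auto intro!: derivative_eq_intros
          simp: has_field_derivative_def[symmetric]\<close>)
  }
qed

text \<open>The equation \<open>k' = 1 / (h' \<circ> k)\<close> gains one order of differentiability at each step: if \<open>k\<close> is of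
  class \<open>n\<close>, then so is the right-hand side.\<close>

lemma Ck_on_inverse_function:
  fixes h k :: "real \<Rightarrow> real"
  assumes "open S" "open T" "k ` T \<subseteq> S" "smooth_on S h"
    and der: "\<And>y. y \<in> T \<Longrightarrow> (k has_field_derivative inverse (deriv h (k y))) (at y)"
    and nz: "\<And>x. x \<in> S \<Longrightarrow> deriv h x \<noteq> 0"
  shows "Ck_on n T k"
proof (induction n)
  case 0
  then show ?case
    using der DERIV_isCont by (auto intro!: continuous_at_imp_continuous_on)
next
  case (Suc n)
  have "Ck_on n S (deriv h)"
  proof (rule Ck_on_cong[OF assms(1)])
    have h: "Ck_on (Suc n) S h"
      using assms(4) smooth_on_def by blast
    then show "Ck_on n S (\<lambda>x. frechet_derivative h (at x) 1)"
      by simp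
    show "frechet_derivative h (at x) 1 = deriv h x" if "x \<in> S" for x
    proof -
      have "(h has_derivative (*) (deriv h x)) (at x)"
        using h that by (metis Ck_on.simps(2) DERIV_deriv_iff_real_differentiable
            has_field_derivative_def)
      then show ?thesis
        using frechet_derivative_at by (metis mult.right_neutral)
    qed
  qed
  then have "Ck_on n T (\<lambda>y. deriv h (k y))"
    by (rule Ck_on_compose[OF assms(2,1,3) Suc])
  then have "Ck_on n T (\<lambda>y. inverse (deriv h (k y)))"
    by (rule Ck_on_inverse[OF assms(2), rotated]) (use nz assms(3) in auto)
  then show ?case
    by (intro Ck_on_SucI[OF assms(2) der[unfolded has_field_derivative_def]]
        Ck_on_bilinear[OF bounded_bilinear_mult] Ck_on_const assms(2))
qed

lemma smooth_on_Pair: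
  fixes f :: "'a::real_normed_vector \<Rightarrow> 'b::euclidean_space"
    and g :: "'a \<Rightarrow> 'c::euclidean_space"
  assumes "open S" "smooth_on S f" "smooth_on S g"
  shows "smooth_on S (\<lambda>x. (f x, g x))"
  unfolding smooth_on_def
proof
  fix k
  have "Ck_on k S (\<lambda>x. (f x, 0::'c))"
    by (rule Ck_on_compose[OF assms(1) open_UNIV, where g = "\<lambda>y. (y, 0)"])
      (use assms(2) in \<open>auto simp: smooth_on_def intro!: Ck_on_linear bounded_linear_Pair
        bounded_linear_ident bounded_linear_zero\<close>)
  moreover have "Ck_on k S (\<lambda>x. (0::'b, g x))"
    by (rule Ck_on_compose[OF assms(1) open_UNIV, where g = "\<lambda>y. (0, y)"])
      (use assms(3) in \<open>auto simp: smooth_on_def intro!: Ck_on_linear bounded_linear_Pair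
        bounded_linear_ident bounded_linear_zero\<close>)
  ultimately show "Ck_on k S (\<lambda>x. (f x, g x))"
    using Ck_on_add[OF assms(1)] by fastforce
qed

lemma smooth_on_compose:
  fixes f :: "'a::real_normed_vector \<Rightarrow> 'b::euclidean_space"
  assumes "open S" "open T" "f ` S \<subseteq> T" "smooth_on S f" "smooth_on T g"
  shows "smooth_on S (\<lambda>x. g (f x))"
  using assms Ck_on_compose unfolding smooth_on_def by blast

lemma smooth_on_has_derivative:
  assumes "smooth_on S f" "x \<in> S"
  shows "(f has_derivative frechet_derivative f (at x)) (at x)"
  using assms Ck_on_Suc_has_derivative unfolding smooth_on_def by blast

lemma smooth_on_has_real_derivative:
  fixes f :: "real \<Rightarrow> real"
  assumes "smooth_on S f" "x \<in> S"
  shows "(f has_field_derivative deriv f x) (at x)"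
  using smooth_on_has_derivative[OF assms]
  by (auto simp: DERIV_deriv_iff_real_differentiable differentiable_def)

lemma smooth_on_sinh: "smooth_on UNIV (sinh :: real \<Rightarrow> real)"
  and smooth_on_cosh: "smooth_on UNIV (cosh :: real \<Rightarrow> real)"
  unfolding smooth_on_def using Ck_on_sinh_cosh by auto

lemma smooth_on_mult:
  fixes f g :: "'a::real_normed_vector \<Rightarrow> real"
  assumes "open S" "smooth_on S f" "smooth_on S g"
  shows "smooth_on S (\<lambda>x. f x * g x)"
  using assms Ck_on_bilinear[OF bounded_bilinear_mult] unfolding smooth_on_def by blast

text \<open>The map moves the fibre over \<open>t\<close> to the fibre over \<open>a t\<close> and rescales it by \<open>b t\<close>.
  Both the parametrization of the hypersurface and its inverse have this form.\<close>

lemma smooth_on_fibre_scaling: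
  fixes a b :: "real \<Rightarrow> real"
  assumes "open J" "smooth_on J a" "smooth_on J b"
  shows "smooth_on (J \<times> UNIV) (\<lambda>x :: real \<times> 'v::euclidean_space. (a (fst x), b (fst x) *\<^sub>R snd x))"
proof (rule smooth_on_Pair)
  let ?S = "J \<times> (UNIV :: 'v set)"
  show S: "open ?S"
    using assms(1) open_Times by blast
  have *: "smooth_on ?S (\<lambda>x. c (fst x))" if "smooth_on J c" for c :: "real \<Rightarrow> real"
    by (rule smooth_on_compose[OF S assms(1) _ _ that])
      (auto simp: smooth_on_def intro: Ck_on_linear[OF bounded_linear_fst S])
  show "smooth_on ?S (\<lambda>x. a (fst x))"
    using * assms(2) by blast
  show "smooth_on ?S (\<lambda>x. b (fst x) *\<^sub>R snd x)"
    using *[OF assms(3)] Ck_on_linear[OF bounded_linear_snd S]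
      Ck_on_bilinear[OF bounded_bilinear_scaleR S]
    unfolding smooth_on_def by blast
qed

section \<open>Differentials of maps between submanifolds\<close>

text \<open>A tangent vector has at least one curve, so that the derivative along curves determines the
  value of the definite description.\<close>

lemma differential_eqI:
  assumes "v \<in> tangent_space M p"
    and "\<And>\<gamma>. curve_at M p v \<gamma> \<Longrightarrow> ((\<phi> \<circ> \<gamma>) has_vector_derivative w) (at 0)"
  shows "differential M \<phi> p v = w"
  unfolding differential_def
proof (rule the_equality)
  show "u = w" if "\<forall>\<gamma>. curve_at M p v \<gamma> \<longrightarrow> ((\<phi> \<circ> \<gamma>) has_vector_derivative u) (at 0)" for u
    using that assms vector_derivative_unique_at unfolding tangent_space_def by blast
qed (use assms in blast)

lemma curve_at_locally:
  assumes "curve_at M p v \<gamma>" "open U" "p \<in> U"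
  obtains e where "e > 0" "smooth_on {-e<..<e} \<gamma>" "\<gamma> ` {-e<..<e} \<subseteq> U \<inter> M"
proof -
  obtain e where e: "e > 0" "smooth_on {-e<..<e} \<gamma>" "\<gamma> ` {-e<..<e} \<subseteq> M" and \<gamma>: "\<gamma> 0 = p"
    "(\<gamma> has_vector_derivative v) (at 0)"
    using assms(1) unfolding curve_at_def by auto
  have "isCont \<gamma> 0"
    using \<gamma>(2) has_vector_derivative_continuous by blast
  then have "\<forall>\<^sub>F t in at 0. \<gamma> t \<in> U"
    using assms(2,3) \<gamma>(1) by (auto simp: isCont_def tendsto_def)
  then obtain d where d: "d > 0" "\<And>t. t \<noteq> 0 \<Longrightarrow> \<bar>t\<bar> < d \<Longrightarrow> \<gamma> t \<in> U"
    by (auto simp: eventually_at dist_real_def)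
  show thesis
  proof (rule that[of "min d e"])
    show "smooth_on {- min d e<..<min d e} \<gamma>"
      unfolding smooth_on_def
    proof
      fix k
      have "Ck_on k {-e<..<e} \<gamma>"
        using e(2) unfolding smooth_on_def by blast
      then show "Ck_on k {- min d e<..<min d e} \<gamma>"
        by (rule Ck_on_subset) auto
    qed
    show "\<gamma> ` {- min d e<..<min d e} \<subseteq> U \<inter> M"
    proof
      fix y assume "y \<in> \<gamma> ` {- min d e<..<min d e}"
      then obtain t where t: "y = \<gamma> t" "- min d e < t" "t < min d e"
        by auto
      then show "y \<in> U \<inter> M"
        using d(2)[of t] e(3) \<gamma>(1) assms(3) by (cases "t = 0") (auto simp: image_subset_iff)
    qed
  qed (use d e in auto)
qed

lemma curve_at_base: "curve_at M p v \<gamma> \<Longrightarrow> p \<in> M"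
  unfolding curve_at_def by force

lemma curve_at_compose_extension:
  assumes "curve_at M p v \<gamma>" "open U" "p \<in> U" "smooth_on U F" "\<And>x. x \<in> U \<inter> M \<Longrightarrow> F x = \<phi> x"
    and "\<phi> ` M \<subseteq> N"
  shows "curve_at N (\<phi> p) (frechet_derivative F (at p) v) (\<phi> \<circ> \<gamma>)"
proof -
  obtain e where e: "e > 0" "smooth_on {-e<..<e} \<gamma>" "\<gamma> ` {-e<..<e} \<subseteq> U \<inter> M"
    using curve_at_locally[OF assms(1-3)] .
  have \<gamma>: "\<gamma> 0 = p" "(\<gamma> has_vector_derivative v) (at 0)"
    using assms(1) unfolding curve_at_def by auto
  have eq: "F (\<gamma> t) = (\<phi> \<circ> \<gamma>) t" if "t \<in> {-e<..<e}" for t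
    using assms(5) e(3) that by (auto simp: image_subset_iff)
  have "smooth_on {-e<..<e} (\<lambda>t. F (\<gamma> t))"
    by (rule smooth_on_compose[OF _ assms(2) _ e(2) assms(4)]) (use e(3) in auto)
  then have "smooth_on {-e<..<e} (\<phi> \<circ> \<gamma>)"
    unfolding smooth_on_def by (intro allI Ck_on_cong[OF open_greaterThanLessThan eq]) auto
  moreover have "(\<phi> \<circ> \<gamma>) ` {-e<..<e} \<subseteq> N"
    using e(3) assms(6) by (auto simp: image_subset_iff)
  moreover have "((\<phi> \<circ> \<gamma>) has_vector_derivative frechet_derivative F (at p) v) (at 0)"
  proof (rule has_vector_derivative_transform_within_open[OF _ open_greaterThanLessThan _ eq])
    show "((\<lambda>t. F (\<gamma> t)) has_vector_derivative frechet_derivative F (at p) v) (at 0)"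
      using vector_derivative_diff_chain_within[of \<gamma> v 0 UNIV F "frechet_derivative F (at p)"]
        \<gamma> smooth_on_has_derivative[OF assms(4,3)] has_derivative_at_withinI
      by (fastforce simp: o_def)
  qed (use e(1) in auto)
  ultimately show ?thesis
    using e(1) \<gamma>(1) unfolding curve_at_def by auto
qed

lemma differential_extension:
  assumes "v \<in> tangent_space M p" "open U" "p \<in> U" "smooth_on U F"
    and "\<And>x. x \<in> U \<inter> M \<Longrightarrow> F x = \<phi> x"
  shows "differential M \<phi> p v = frechet_derivative F (at p) v"
proof (rule differential_eqI[OF assms(1)])
  fix \<gamma> assume "curve_at M p v \<gamma>"
  from curve_at_compose_extension[OF this assms(2-5), of UNIV]
  show "((\<phi> \<circ> \<gamma>) has_vector_derivative frechet_derivative F (at p) v) (at 0)"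
    by (auto simp: curve_at_def)
qed

text \<open>A smooth map carries curves to curves, and the velocity of the image depends only on the velocity
  of the original: near the base point the map agrees with a smooth function on an open set, to which
  the ordinary chain rule applies.\<close>

lemma curve_at_compose:
  assumes "curve_at M p v \<gamma>" "smooth_map M \<phi>" "\<phi> ` M \<subseteq> N"
  shows "curve_at N (\<phi> p) (differential M \<phi> p v) (\<phi> \<circ> \<gamma>)"
proof -
  have v: "v \<in> tangent_space M p"
    using assms(1) unfolding tangent_space_def by auto
  obtain U F where U: "open U" "p \<in> U" "smooth_on U F" "\<And>x. x \<in> U \<inter> M \<Longrightarrow> F x = \<phi> x"
    using assms(2) curve_at_base[OF assms(1)] unfolding smooth_map_def by metis
  show ?thesis
    using curve_at_compose_extension[OF assms(1) U assms(3)]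
      differential_extension[where M = M and \<phi> = \<phi> and F = F, OF v U] by simp
qed

lemma differential_tangent:
  assumes "v \<in> tangent_space M p" "smooth_map M \<phi>" "\<phi> ` M \<subseteq> N"
  shows "differential M \<phi> p v \<in> tangent_space N (\<phi> p)"
  using assms curve_at_compose unfolding tangent_space_def by blast

lemma smooth_map_extension:
  assumes "open U" "M \<subseteq> U" "smooth_on U F" "\<And>x. x \<in> M \<Longrightarrow> F x = \<phi> x"
  shows "smooth_map M \<phi>"
  using assms unfolding smooth_map_def by blast

lemma differential_linear:
  assumes "v \<in> tangent_space M p" "bounded_linear L"
  shows "differential M L p v = L v"
proof -
  have "frechet_derivative L (at p) = L"
    by (rule frechet_derivative_at[OF bounded_linear_imp_has_derivative[OF assms(2)], symmetric])
  moreover have "smooth_on UNIV L"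
    using Ck_on_linear[OF assms(2) open_UNIV] by (simp add: smooth_on_def)
  ultimately show ?thesis
    using differential_extension[OF assms(1) open_UNIV, of L L] by simp
qed

text \<open>A curve and its image under \<open>\<psi> \<circ> \<phi>\<close> coincide near \<open>0\<close>, so their velocities agree.\<close>

lemma differential_left_inverse:
  assumes "v \<in> tangent_space M p" "smooth_map M \<phi>" "\<phi> ` M \<subseteq> N" "smooth_map N \<psi>"
    and "\<And>x. x \<in> M \<Longrightarrow> \<psi> (\<phi> x) = x"
  shows "differential N \<psi> (\<phi> p) (differential M \<phi> p v) = v"
proof -
  obtain \<gamma> where \<gamma>: "curve_at M p v \<gamma>"
    using assms(1) unfolding tangent_space_def by auto
  obtain e where e: "e > 0" "\<gamma> ` {-e<..<e} \<subseteq> M"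
    using \<gamma> unfolding curve_at_def by auto
  have "curve_at UNIV (\<psi> (\<phi> p)) (differential N \<psi> (\<phi> p) (differential M \<phi> p v)) (\<psi> \<circ> (\<phi> \<circ> \<gamma>))"
    by (intro curve_at_compose[OF curve_at_compose[OF \<gamma>]] assms) auto
  then have "((\<psi> \<circ> (\<phi> \<circ> \<gamma>)) has_vector_derivative
      differential N \<psi> (\<phi> p) (differential M \<phi> p v)) (at 0)"
    by (auto simp: curve_at_def)
  then have "(\<gamma> has_vector_derivative differential N \<psi> (\<phi> p) (differential M \<phi> p v)) (at 0)"
    by (rule has_vector_derivative_transform_within_open[where S = "{-e<..<e}"])
      (use e assms(5) in \<open>auto simp: image_subset_iff\<close>)
  then show ?thesis
    using \<gamma> vector_derivative_unique_at unfolding curve_at_def by blast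
qed

text \<open>Differentiate \<open>\<gamma> t \<bullet> \<gamma> t = 1\<close> at \<open>t = 0\<close>.\<close>

lemma tangent_space_sphere:
  assumes "v \<in> tangent_space (unit_sphere :: (real^'m) set) u"
  shows "u \<bullet> v = 0"
proof -
  obtain \<gamma> e where \<gamma>: "\<gamma> 0 = u" "(\<gamma> has_vector_derivative v) (at 0)" "e > 0"
      "\<gamma> ` {-e<..<e} \<subseteq> unit_sphere"
    using assms unfolding tangent_space_def curve_at_def by blast
  have "((\<lambda>t. \<gamma> t \<bullet> \<gamma> t) has_derivative (\<lambda>s. \<gamma> 0 \<bullet> (s *\<^sub>R v) + (s *\<^sub>R v) \<bullet> \<gamma> 0)) (at 0)"
    using \<gamma>(2) unfolding has_vector_derivative_def by (intro has_derivative_inner)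
  moreover have "((\<lambda>t. \<gamma> t \<bullet> \<gamma> t) has_derivative (\<lambda>s. 0)) (at 0)"
    by (rule has_derivative_transform_within_open[OF has_derivative_const[of 1],
          where s = "{-e<..<e}"])
      (use \<gamma>(3,4) in \<open>auto simp: image_subset_iff unit_sphere_def dot_square_norm\<close>)
  ultimately have "(\<lambda>s. \<gamma> 0 \<bullet> (s *\<^sub>R v) + (s *\<^sub>R v) \<bullet> \<gamma> 0) = (\<lambda>s. 0)"
    by (rule has_derivative_unique)
  from fun_cong[OF this, of 1] show ?thesis
    using \<gamma>(1) by (simp add: inner_commute)
qed

section \<open>The isometry\<close>

text \<open>Injectivity follows from the mean value theorem; a continuous injective function on the line is
  open, and the inverse function theorem gives the derivative of the inverse.\<close>

lemma smooth_inverse_function: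
  fixes h :: "real \<Rightarrow> real"
  assumes "smooth_on UNIV h" "\<And>t. deriv h t \<noteq> 0"
  shows "inj h" "open (range h)" "smooth_on (range h) (inv h)"
proof -
  note der = smooth_on_has_real_derivative[OF assms(1) UNIV_I]
  have cont: "continuous_on UNIV h"
    using assms(1) unfolding smooth_on_def by (metis Ck_on.simps(1))
  show inj: "inj h"
  proof (rule linorder_injI)
    fix x y :: real assume "x < y"
    then obtain z where "h y - h x = (y - x) * deriv h z"
      using MVT2[of x y h "deriv h"] der by blast
    then show "h x \<noteq> h y"
      using assms(2)[of z] \<open>x < y\<close> by auto
  qed
  show op: "open (range h)"
    using injective_eq_1d_open_map_UNIV[of UNIV h] cont inj by auto
  have "(inv h has_field_derivative inverse (deriv h (inv h y))) (at y)" if "y \<in> range h" for y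
  proof -
    let ?d = "deriv h (inv h y)"
    have "(inv h has_derivative (*) (inverse ?d)) (at (h (inv h y)))"
      using der[of "inv h y"] assms(2)[of "inv h y"] inj
      by (intro has_derivative_inverse_strong[OF open_UNIV UNIV_I cont, where f' = "(*) ?d"])
        (auto simp: has_field_derivative_def fun_eq_iff)
    then show ?thesis
      using that by (simp add: has_field_derivative_def f_inv_into_f)
  qed
  then show "smooth_on (range h) (inv h)"
    unfolding smooth_on_def
    using Ck_on_inverse_function[OF open_UNIV op subset_UNIV assms(1)] assms(2) by blast
qed

lemma differential_fibre_scaling:
  fixes M :: "(real \<times> 'v::euclidean_space) set" and a b :: "real \<Rightarrow> real"
  assumes "smooth_on UNIV a" "smooth_on UNIV b" "v \<in> tangent_space M p"
    and "(a has_field_derivative a') (at (fst p))" "(b has_field_derivative b') (at (fst p))"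
  shows "differential M (\<lambda>x. (a (fst x), b (fst x) *\<^sub>R snd x)) p v =
    (a' * fst v, (b' * fst v) *\<^sub>R snd p + b (fst p) *\<^sub>R snd v)"
proof -
  let ?F = "\<lambda>x :: real \<times> 'v. (a (fst x), b (fst x) *\<^sub>R snd x)"
  have "smooth_on UNIV ?F"
    using smooth_on_fibre_scaling[OF open_UNIV assms(1,2)] by simp
  then have D: "differential M ?F p v = frechet_derivative ?F (at p) v"
    by (intro differential_extension[OF assms(3) open_UNIV]) auto
  have *: "((\<lambda>x. c (fst x)) has_derivative (\<lambda>v. c' * fst v)) (at p)"
    if "(c has_field_derivative c') (at (fst p))" for c :: "real \<Rightarrow> real" and c'
    using has_derivative_compose[OF has_derivative_fst[OF has_derivative_ident]
        that[unfolded has_field_derivative_def]] by simp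
  have "(?F has_derivative (\<lambda>v. (a' * fst v, b (fst p) *\<^sub>R snd v + (b' * fst v) *\<^sub>R snd p))) (at p)"
    by (intro has_derivative_Pair has_derivative_scaleR * assms(4,5) has_derivative_snd
        has_derivative_ident)
  from frechet_derivative_at[OF this, symmetric] D show ?thesis
    by (simp add: add.commute)
qed

lemma induced_tangent:
  assumes "v \<in> tangent_space M p" "w \<in> tangent_space M p"
  shows "induced M g p v w = g p v w"
  using assms by (simp add: induced_def pullback_def differential_linear bounded_linear_ident)

lemma minkowski_inner: "minkowski p v w = - (fst v * fst w) + snd v \<bullet> snd w"
  by (simp add: minkowski_def inner_vec_def)

lemma snd_tangent_cylinder:
  assumes "v \<in> tangent_space (cylinder :: (real \<times> (real^'m)) set) p"
  shows "snd v \<in> tangent_space unit_sphere (snd p)"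
proof -
  have "smooth_map (cylinder :: (real \<times> (real^'m)) set) snd"
    by (rule smooth_map_extension[of UNIV])
      (auto simp: smooth_on_def intro: Ck_on_linear[OF bounded_linear_snd])
  then have "differential cylinder snd p v \<in> tangent_space unit_sphere (snd p)"
    by (rule differential_tangent[OF assms]) (auto simp: cylinder_def)
  then show ?thesis
    using differential_linear[OF assms bounded_linear_snd] by simp
qed

lemma cylinder_metric_tangent:
  fixes p :: "real \<times> (real^'m)"
  assumes "v \<in> tangent_space cylinder p" "w \<in> tangent_space cylinder p"
  shows "cylinder_metric \<alpha> p v w = ((deriv \<alpha> (fst p))\<^sup>2 - (\<alpha> (fst p))\<^sup>2) * (fst v * fst w)
    + (\<alpha> (fst p) * cosh (fst p))\<^sup>2 * (snd v \<bullet> snd w)"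
  using assms
  by (simp add: cylinder_metric_def Let_def pullback_def round_metric_def induced_tangent
      differential_linear bounded_linear_fst bounded_linear_snd snd_tangent_cylinder power_mult_distrib)

text \<open>The computation at the heart of the theorem: pulled back to the cylinder, the Minkowski form is
  the given metric.\<close>

lemma minkowski_parametrization:
  fixes p :: "real \<times> (real^'m)"
  assumes "smooth_on UNIV \<alpha>"
    and \<psi>: "\<psi> = (\<lambda>x. (\<alpha> (fst x) * sinh (fst x), (\<alpha> (fst x) * cosh (fst x)) *\<^sub>R snd x))"
    and p: "p \<in> cylinder"
    and v: "v \<in> tangent_space cylinder p" and w: "w \<in> tangent_space cylinder p"
  shows "minkowski (\<psi> p) (differential cylinder \<psi> p v) (differential cylinder \<psi> p w) =
    cylinder_metric \<alpha> p v w"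
proof -
  define t where "t = fst p"
  define a where "a = deriv \<alpha> t * sinh t + \<alpha> t * cosh t"
  define b where "b = deriv \<alpha> t * cosh t + \<alpha> t * sinh t"
  define c where "c = \<alpha> t * cosh t"
  note der = smooth_on_has_real_derivative[OF assms(1) UNIV_I]
  have ders: "((\<lambda>t. \<alpha> t * sinh t) has_field_derivative a) (at (fst p))"
    "((\<lambda>t. \<alpha> t * cosh t) has_field_derivative b) (at (fst p))"
    unfolding a_def b_def t_def[symmetric]
    by (auto intro!: derivative_eq_intros der[of t])
  have smooth: "smooth_on UNIV (\<lambda>t. \<alpha> t * sinh t)" "smooth_on UNIV (\<lambda>t. \<alpha> t * cosh t)"
    using smooth_on_mult[OF open_UNIV assms(1)] smooth_on_sinh smooth_on_cosh by blast+
  have D: "differential cylinder \<psi> p z = (a * fst z, (b * fst z) *\<^sub>R snd p + c *\<^sub>R snd z)"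
    if "z \<in> tangent_space cylinder p" for z
    unfolding \<psi> c_def t_def by (rule differential_fibre_scaling[OF smooth that ders])
  have orth: "snd p \<bullet> snd v = 0" "snd p \<bullet> snd w = 0"
    using tangent_space_sphere snd_tangent_cylinder v w by blast+
  have unit: "snd p \<bullet> snd p = 1"
    using p by (auto simp: cylinder_def unit_sphere_def dot_square_norm)
  \<comment> \<open>\<open>a\<close> and \<open>b\<close> are the derivatives of the time coordinate and of the radius; the mixed terms
    \<open>2 * \<alpha> * \<alpha>' * sinh * cosh\<close> in their squares cancel.\<close>
  have "b\<^sup>2 - a\<^sup>2 = ((deriv \<alpha> t)\<^sup>2 - (\<alpha> t)\<^sup>2) * ((cosh t)\<^sup>2 - (sinh t)\<^sup>2)"
    unfolding a_def b_def by (simp add: power2_eq_square algebra_simps)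
  then have ab: "b\<^sup>2 - a\<^sup>2 = (deriv \<alpha> t)\<^sup>2 - (\<alpha> t)\<^sup>2"
    by (simp add: hyperbolic_pythagoras)
  have "minkowski (\<psi> p) (differential cylinder \<psi> p v) (differential cylinder \<psi> p w) =
      (b\<^sup>2 - a\<^sup>2) * (fst v * fst w) + c\<^sup>2 * (snd v \<bullet> snd w)"
    by (simp add: minkowski_inner D v w inner_add_left inner_add_right orth unit
        inner_commute[of "snd v" "snd p"] power2_eq_square algebra_simps)
  then show ?thesis
    by (simp add: ab cylinder_metric_tangent[OF v w] c_def t_def)
qed

theorem theorem3p1:
  fixes n :: nat and \<alpha> h f :: "real \<Rightarrow> real"
  assumes "n \<ge> 1" and "CARD('m::finite) = n + 1"
    and "smooth_on UNIV \<alpha>"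
    and "\<And>t. \<alpha> t > 0"
    and "h = (\<lambda>t. \<alpha> t * sinh t)"
    and "\<And>t. deriv h t \<noteq> 0"
    and "f = \<alpha> \<circ> inv h"
  shows "isometric
    (dS (range h) f :: (real \<times> (real^'m)) set) (induced (dS (range h) f) minkowski)
    (cylinder :: (real \<times> (real^'m)) set) (cylinder_metric \<alpha>)"
proof -
  define M :: "(real \<times> (real^'m)) set" where "M = dS (range h) f"
  define N :: "(real \<times> (real^'m)) set" where "N = cylinder"
  define c where "c = (\<lambda>t. \<alpha> t * cosh t)"
  define k where "k = inv h"
  define \<phi> :: "real \<times> (real^'m) \<Rightarrow> real \<times> (real^'m)"
    where "\<phi> = (\<lambda>x. (k (fst x), inverse (c (k (fst x))) *\<^sub>R snd x))"
  define \<psi> :: "real \<times> (real^'m) \<Rightarrow> real \<times> (real^'m)"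
    where "\<psi> = (\<lambda>x. (h (fst x), c (fst x) *\<^sub>R snd x))"
  have smooth: "smooth_on UNIV h" "smooth_on UNIV c"
    unfolding assms(5) c_def
    using smooth_on_mult[OF open_UNIV assms(3)] smooth_on_sinh smooth_on_cosh by blast+
  note h = smooth_inverse_function[OF smooth(1) assms(6)]
  have kh [simp]: "k (h t) = t" for t
    using h(1) by (simp add: k_def)
  have c_pos: "c t > 0" for t
    using assms(4) by (simp add: c_def)
  \<comment> \<open>The defining equation at time \<open>h t\<close> reads \<open>\<bar>y\<bar>\<^sup>2 = (\<alpha> t)\<^sup>2 + (h t)\<^sup>2 = (c t)\<^sup>2\<close>: each time slice is a
    round sphere, and it is nondegenerate because \<open>c t\<close> is positive.\<close>
  have in_M: "x \<in> M \<longleftrightarrow> (\<exists>t. fst x = h t \<and> norm (snd x) = c t)" for x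
  proof -
    have "- (h t)\<^sup>2 + y \<bullet> y = (\<alpha> t)\<^sup>2 \<longleftrightarrow> norm y = c t" for t and y :: "real^'m"
    proof -
      have "(\<alpha> t)\<^sup>2 + (h t)\<^sup>2 = (\<alpha> t)\<^sup>2 * (1 + (sinh t)\<^sup>2)"
        by (simp add: assms(5) power_mult_distrib algebra_simps)
      then have "(\<alpha> t)\<^sup>2 + (h t)\<^sup>2 = (c t)\<^sup>2"
        by (simp add: c_def power_mult_distrib cosh_square_eq add.commute)
      then have "- (h t)\<^sup>2 + y \<bullet> y = (\<alpha> t)\<^sup>2 \<longleftrightarrow> (norm y)\<^sup>2 = (c t)\<^sup>2"
        by (auto simp: dot_square_norm)
      then show ?thesis
        using c_pos[of t] by (simp add: power2_eq_iff_nonneg)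
    qed
    moreover have "x \<in> M \<longleftrightarrow> (\<exists>t. fst x = h t \<and> - (h t)\<^sup>2 + snd x \<bullet> snd x = (\<alpha> t)\<^sup>2)"
      using kh by (auto simp: M_def dS_def assms(7) k_def[symmetric] inner_vec_def power2_eq_square)
    ultimately show ?thesis
      by simp
  qed
  have in_N: "x \<in> N \<longleftrightarrow> norm (snd x) = 1" for x
    by (cases x) (auto simp: N_def cylinder_def unit_sphere_def)
  have \<phi>M: "\<phi> x \<in> N" "\<psi> (\<phi> x) = x" if "x \<in> M" for x
    using that c_pos abs_of_pos[OF c_pos] by (auto simp: in_M in_N \<phi>_def \<psi>_def prod_eq_iff less_imp_neq[THEN not_sym])
  have \<psi>N: "\<psi> x \<in> M" "\<phi> (\<psi> x) = x" if "x \<in> N" for x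
    using that c_pos abs_of_pos[OF c_pos] by (auto simp: in_M in_N \<phi>_def \<psi>_def prod_eq_iff less_imp_neq[THEN not_sym])
  have bij: "bij_betw \<phi> M N"
    by (rule bij_betwI[where g = \<psi>]) (use \<phi>M \<psi>N in auto)
  have sm\<phi>: "smooth_map M \<phi>"
  proof (rule smooth_map_extension)
    have "smooth_on (range h) (\<lambda>s. c (k s))"
      by (rule smooth_on_compose[OF h(2) open_UNIV subset_UNIV h(3)[folded k_def] smooth(2)])
    then have "smooth_on (range h) (\<lambda>s. inverse (c (k s)))"
      using Ck_on_inverse[OF h(2)] c_pos unfolding smooth_on_def by (metis less_irrefl)
    then show "smooth_on (range h \<times> UNIV) \<phi>"
      unfolding \<phi>_def by (rule smooth_on_fibre_scaling[OF h(2) h(3)[folded k_def]])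
    show "open (range h \<times> (UNIV :: (real^'m) set))"
      using h(2) open_Times by blast
    show "M \<subseteq> range h \<times> UNIV"
      by (auto simp: in_M)
  qed auto
  have sm\<psi>: "smooth_map N \<psi>"
    by (rule smooth_map_extension[of UNIV])
      (use smooth_on_fibre_scaling[OF open_UNIV smooth] in \<open>auto simp: \<psi>_def\<close>)
  have "smooth_map N (inv_into M \<phi>)"
  proof -
    have "inv_into M \<phi> x = \<psi> x" if "x \<in> N" for x
      using \<psi>N[OF that] bij by (metis bij_betw_imp_inj_on inv_into_f_f)
    then show ?thesis
      using sm\<psi> unfolding smooth_map_def by (metis IntD2)
  qed
  then have diffeo: "diffeomorphism M N \<phi>"
    using bij sm\<phi> unfolding diffeomorphism_def by blast
  have "pullback M \<phi> (cylinder_metric \<alpha>) p v w = induced M minkowski p v w"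
    if p: "p \<in> M" and v: "v \<in> tangent_space M p" and w: "w \<in> tangent_space M p" for p v w
  proof -
    let ?D = "differential M \<phi> p"
    have sub: "\<phi> ` M \<subseteq> N"
      using \<phi>M by auto
    have tan: "?D z \<in> tangent_space cylinder (\<phi> p)" "differential cylinder \<psi> (\<phi> p) (?D z) = z"
      if "z \<in> tangent_space M p" for z
      using differential_tangent[OF that sm\<phi> sub]
        differential_left_inverse[OF that sm\<phi> sub sm\<psi> \<phi>M(2)] by (auto simp: N_def)
    have "cylinder_metric \<alpha> (\<phi> p) (?D v) (?D w) = minkowski (\<psi> (\<phi> p)) v w"
      using minkowski_parametrization[OF assms(3), of \<psi> "\<phi> p" "?D v" "?D w"] tan v w \<phi>M(1)[OF p]
      by (simp add: \<psi>_def assms(5) c_def N_def)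
    also have "\<dots> = induced M minkowski p v w"
      using \<phi>M(2)[OF p] induced_tangent[OF v w] by simp
    finally show ?thesis
      by (simp add: pullback_def)
  qed
  with diffeo show ?thesis
    unfolding isometric_def M_def N_def by blast
qed

end
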